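(* The function defined on $\mathcal H$ by $$f(z)\,=\,z\,+\,4\,\frac{E_4(z)}{E_4'(z)}$$ is a solution to $$\{f,z\}\,=\,4\pi^2\,E_4(z).$$
   Context: $\mathcal H=\{z\in\mathbb C:\Im z>0\}$ is the upper half-plane, and $'$ denotes $d/dz$. The Eisenstein series $E_4$ is $E_4(z)=1+240\sum_{n\ge1}\sigma_3(n)e^{2\pi i n z}$, where $\sigma_3(n)$ is the sum of the cubes of the positive divisors of $n$. The Schwarz derivative is normalized as $$\{f,z\}=2\left(\frac{f''}{f'}\right)'-\left(\frac{f''}{f'}\right)^2 .$$ The function $f$ is meromorphic on $\mathcal H$, and the equation is understood as an identity of meromorphic functions on $\mathcal H$. *)

theory Defs
  imports "HOL-Complex_Analysis.Complex_Analysis"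
begin

abbreviation upper_half_plane :: "complex set" where
  "upper_half_plane \<equiv> {z. Im z > 0}"

definition sigma3 :: "nat \<Rightarrow> nat" where
  "sigma3 n = (\<Sum>d | d dvd n. d ^ 3)"

text \<open>The index is shifted, so that the series starts with the term for 1. The value is
  meaningful only on the upper half-plane, where the series converges.\<close>

definition E4 :: "complex \<Rightarrow> complex" where
  "E4 z = 1 + 240 * (\<Sum>n. of_nat (sigma3 (Suc n)) * exp (2 * of_real pi * \<i> * of_nat (Suc n) * z))"

text \<open>The normalization is twice the most common one. At poles of \<open>f\<close> and zeros of \<open>f'\<close> the value is
  an artefact of totalized division and \<^const>\<open>deriv\<close>; as a meromorphic function the
  derivative is determined by its values elsewhere.\<close>

definition schwarz_deriv :: "(complex \<Rightarrow> complex) \<Rightarrow> complex \<Rightarrow> complex" where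
  "schwarz_deriv f z =
     2 * deriv (\<lambda>w. deriv (deriv f) w / deriv f w) z - (deriv (deriv f) z / deriv f z) ^ 2"

text \<open>Equality of meromorphic functions: the two functions agree on \<open>A\<close> outside a set that
  has no accumulation point in \<open>A\<close>.\<close>

definition mero_eq_on :: "complex set \<Rightarrow> (complex \<Rightarrow> complex) \<Rightarrow> (complex \<Rightarrow> complex) \<Rightarrow> bool" where
  "mero_eq_on A f g \<longleftrightarrow> f meromorphic_on A \<and> g meromorphic_on A \<and> (\<forall>\<^sub>\<approx>z\<in>A. f z = g z)"

end

theory Submission
  imports Defs
begin

text \<open>Write \<open>D = (2 \<pi> i)\<^sup>-\<^sup>1 d/dz\<close>, \<open>N = D E\<^sub>4 = (E\<^sub>2 E\<^sub>4 - E\<^sub>6) / 3\<close> and \<open>\<Delta> = E\<^sub>4\<^sup>3 - E\<^sub>6\<^sup>2\<close>. Ramanujan's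
  differential equations for \<open>E\<^sub>2, E\<^sub>4, E\<^sub>6\<close> give \<open>f' = - (5 / 9) \<Delta> / N\<^sup>2\<close> and \<open>D \<Delta> = E\<^sub>2 \<Delta>\<close>, so
  \<open>f'' / f' = 2 \<pi> i (E\<^sub>2 - 2 (D N) / N)\<close>, and the claim is a polynomial identity in
  \<open>E\<^sub>2, E\<^sub>4, E\<^sub>6\<close>. Ramanujan's equations amount to convolution identities for the divisor
  functions. These are obtained without modular forms, from a transformation of the solutions of
  \<open>a x + b y = n\<close> in positive integers, following Liouville and Skoruppa.\<close>

subsection \<open>Sums over the solutions of a x + b y = n\<close>

definition divisor_sigma :: "nat \<Rightarrow> nat \<Rightarrow> nat" where
  "divisor_sigma k n = (\<Sum>d | d dvd n. d ^ k)"

definition factor_pairs :: "nat \<Rightarrow> (nat \<times> nat) set" where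
  "factor_pairs n = {(a, x). 0 < a \<and> 0 < x \<and> a * x = n}"

definition quads :: "nat \<Rightarrow> (nat \<times> nat \<times> nat \<times> nat) set" where
  "quads n = {(a, b, x, y). 0 < a \<and> 0 < b \<and> 0 < x \<and> 0 < y \<and> a * x + b * y = n}"

text \<open>Every number divides 0, and a sum over an infinite set is 0 by convention. This default
  gives the generating series constant term 0 and lets convolutions run over all of
  \<open>0..n\<close>.\<close>

lemma divisor_sigma_0 [simp]: "divisor_sigma k 0 = 0"
  by (simp add: divisor_sigma_def)

lemma finite_factor_pairs [simp]: "finite (factor_pairs n)"
proof (rule finite_subset)
  show "factor_pairs n \<subseteq> {..n} \<times> {..n}"
    by (auto simp: factor_pairs_def)
qed auto

lemma finite_quads [simp]: "finite (quads n)"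
proof (rule finite_subset)
  show "quads n \<subseteq> {..n} \<times> {..n} \<times> {..n} \<times> {..n}"
    by (auto simp: quads_def intro: trans_le_add1 trans_le_add2)
qed auto

lemma sum_divisors_conv_factor_pairs:
  assumes "0 < n"
  shows "(\<Sum>d | d dvd n. f d) = (\<Sum>(a, x)\<in>factor_pairs n. f a)"
  by (rule sum.reindex_bij_witness[where i = fst and j = "\<lambda>d. (d, n div d)"])
     (use assms in \<open>auto simp: factor_pairs_def dest: dvd_div_eq_0_iff\<close>)

lemma divisor_sigma_conv_factor_pairs:
  "divisor_sigma k n = (\<Sum>(a, x)\<in>factor_pairs n. a ^ k)"
proof (cases "n = 0")
  case True
  then have "factor_pairs n = {}"
    by (auto simp: factor_pairs_def)
  with True show ?thesis by simp
next
  case False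
  then show ?thesis
    by (simp add: divisor_sigma_def sum_divisors_conv_factor_pairs)
qed

text \<open>Group the solutions by \<open>i = a * x\<close>: then \<open>(a, x)\<close> factors
  \<open>i\<close> and \<open>(b, y)\<close> factors \<open>n - i\<close>, independently of each
  other.\<close>

lemma divisor_sigma_convolution:
  "(\<Sum>i=0..n. divisor_sigma j i * divisor_sigma k (n - i)) = (\<Sum>(a, b, x, y)\<in>quads n. a ^ j * b ^ k)"
proof -
  have "(\<Sum>i=0..n. divisor_sigma j i * divisor_sigma k (n - i)) =
        (\<Sum>i\<in>{0..n}. \<Sum>p\<in>factor_pairs i \<times> factor_pairs (n - i). fst (fst p) ^ j * fst (snd p) ^ k)"
    by (simp add: divisor_sigma_conv_factor_pairs sum_product sum.cartesian_product case_prod_unfold)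
  also have "\<dots> = (\<Sum>t\<in>(SIGMA i:{0..n}. factor_pairs i \<times> factor_pairs (n - i)).
      fst (fst (snd t)) ^ j * fst (snd (snd t)) ^ k)"
    by (subst sum.Sigma) (auto simp: case_prod_unfold)
  also have "\<dots> = (\<Sum>(a, b, x, y)\<in>quads n. a ^ j * b ^ k)"
    by (rule sum.reindex_bij_witness[where i = "\<lambda>(a, b, x, y). (a * x, (a, x), (b, y))"
          and j = "\<lambda>(i, (a, x), (b, y)). (a, b, x, y)"])
       (auto simp: factor_pairs_def quads_def)
  finally show ?thesis .
qed

lemma sum_quads_swap:
  "(\<Sum>(a, b, x, y)\<in>quads n. f a b) = (\<Sum>(a, b, x, y)\<in>quads n. f b a)"
  by (rule sum.reindex_bij_witness[where i = "\<lambda>(a, b, x, y). (b, a, y, x)"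
        and j = "\<lambda>(a, b, x, y). (b, a, y, x)"])
     (auto simp: quads_def)

lemma sum_quads_trichotomy:
  fixes f :: "nat \<times> nat \<times> nat \<times> nat \<Rightarrow> 'b :: comm_monoid_add" and u v :: "_ \<Rightarrow> nat"
  shows "sum f (quads n) = sum f {q \<in> quads n. u q < v q} + sum f {q \<in> quads n. v q < u q}
           + sum f {q \<in> quads n. u q = v q}"
proof -
  have "quads n = {q \<in> quads n. u q < v q} \<union> {q \<in> quads n. v q < u q} \<union> {q \<in> quads n. u q = v q}"
    by auto
  also have "sum f \<dots> = sum f {q \<in> quads n. u q < v q} + sum f {q \<in> quads n. v q < u q}
           + sum f {q \<in> quads n. u q = v q}"
    by (subst sum.union_disjoint; (subst sum.union_disjoint)?) auto
  finally show ?thesis .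
qed

text \<open>For \<open>x = y\<close> the equation reads \<open>(a + b) * x = n\<close>, so
  \<open>d = a + b\<close> is a divisor of \<open>n\<close> and \<open>a\<close> is any number
  strictly between 0 and \<open>d\<close>.\<close>

lemma sum_quads_diagonal_xy:
  assumes "0 < n"
  shows "(\<Sum>(a, b, x, y) | (a, b, x, y) \<in> quads n \<and> x = y. f a b) =
         (\<Sum>d | d dvd n. \<Sum>a=1..<d. f a (d - a))"
proof -
  have "(\<Sum>d | d dvd n. \<Sum>a=1..<d. f a (d - a)) =
        (\<Sum>(d, a)\<in>(SIGMA d:{d. d dvd n}. {1..<d}). f a (d - a))"
    using assms by (subst sum.Sigma) auto
  also have "\<dots> = (\<Sum>(a, b, x, y) | (a, b, x, y) \<in> quads n \<and> x = y. f a b)"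
    by (rule sum.reindex_bij_witness[where j = "\<lambda>(d, a). (a, d - a, n div d, n div d)"
          and i = "\<lambda>(a, b, x, y). (a + b, a)"])
       (use assms in \<open>auto simp: quads_def simp flip: add_mult_distrib dest: dvd_div_eq_0_iff\<close>)
  finally show ?thesis by simp
qed

text \<open>For \<open>a = b\<close> the equation reads \<open>a * (x + y) = n\<close>. The factor
  \<open>n div d - 1\<close> counts the ways to split \<open>n div d\<close> into two positive
  parts.\<close>

lemma sum_quads_diagonal_ab:
  fixes f :: "nat \<Rightarrow> 'a :: comm_semiring_1"
  assumes "0 < n"
  shows "(\<Sum>(a, b, x, y) | (a, b, x, y) \<in> quads n \<and> a = b. f a) =
         (\<Sum>d | d dvd n. of_nat (n div d - 1) * f d)"
proof -
  have "(\<Sum>d | d dvd n. of_nat (n div d - 1) * f d) = (\<Sum>d | d dvd n. \<Sum>x=1..<n div d. f d)"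
    by simp
  also have "\<dots> = (\<Sum>(d, x)\<in>(SIGMA d:{d. d dvd n}. {1..<n div d}). f d)"
    using assms by (subst sum.Sigma) auto
  also have "\<dots> = (\<Sum>(a, b, x, y) | (a, b, x, y) \<in> quads n \<and> a = b. f a)"
    by (rule sum.reindex_bij_witness[where j = "\<lambda>(d, x). (d, d, x, n div d - x)"
          and i = "\<lambda>(a, b, x, y). (a, x)"])
       (use assms in \<open>auto simp: quads_def simp flip: add_mult_distrib2 dest: dvd_div_eq_0_iff\<close>)
  finally show ?thesis by simp
qed

text \<open>The map
  \<open>(a, b, x, y) \<mapsto> (a, a + b, x - y, y)\<close> carries the solutions with \<open>y < x\<close> to those with \<open>a < b\<close>,
  and the symmetries of \<open>g\<close> turn the transported summand into \<open>g a (- b)\<close>. Only the two diagonals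
  survive.\<close>

lemma sum_quads_symmetric:
  fixes g :: "'a :: ring_1 \<Rightarrow> 'a \<Rightarrow> 'b :: comm_ring_1"
  assumes n: "0 < n"
    and comm: "\<And>a b. g a b = g b a"
    and third: "\<And>a b. g a b = g a (- a - b)"
    and even: "\<And>a b. g (- a) (- b) = g a b"
  shows "(\<Sum>(a, b, x, y)\<in>quads n. g (of_nat a) (of_nat b) - g (of_nat a) (- of_nat b)) =
         (\<Sum>d | d dvd n. (\<Sum>a=1..<d. g (of_nat a) (of_nat (d - a)))
            - of_nat (n div d - 1) * g (of_nat d) (- of_nat d))"
proof -
  let ?g = "\<lambda>(a, b, x :: nat, y :: nat). g (of_nat a) (of_nat b)"
  let ?h = "\<lambda>(a, b, x :: nat, y :: nat). g (of_nat a) (- of_nat b)"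
  have h1: "g a (b - a) = g a (- b)" for a b
    using third[of a "b - a"] by simp
  \<comment> \<open>Commute the arguments, apply \<open>h1\<close> with the roles exchanged, commute
    again and change both signs.\<close>
  have h2: "g (a - b) b = g a (- b)" for a b
    by (metis comm even h1 minus_minus)
  have 1: "sum ?g {q \<in> quads n. (case q of (a, b, x, y) \<Rightarrow> y) < (case q of (a, b, x, y) \<Rightarrow> x)} =
        sum ?h {q \<in> quads n. (case q of (a, b, x, y) \<Rightarrow> a) < (case q of (a, b, x, y) \<Rightarrow> b)}"
    by (rule sum.reindex_bij_witness[where j = "\<lambda>(a, b, x, y). (a, a + b, x - y, y)"
          and i = "\<lambda>(a, b, x, y). (a, b - a, x + y, y)"])
       (auto simp: quads_def algebra_simps h1[symmetric] dest!: less_imp_Suc_add)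
  \<comment> \<open>The mirrored map covers the other half: \<open>x < y\<close> goes to
    \<open>b < a\<close>.\<close>
  have 2: "sum ?g {q \<in> quads n. (case q of (a, b, x, y) \<Rightarrow> x) < (case q of (a, b, x, y) \<Rightarrow> y)} =
        sum ?h {q \<in> quads n. (case q of (a, b, x, y) \<Rightarrow> b) < (case q of (a, b, x, y) \<Rightarrow> a)}"
    by (rule sum.reindex_bij_witness[where j = "\<lambda>(a, b, x, y). (a + b, b, x, y - x)"
          and i = "\<lambda>(a, b, x, y). (a - b, b, x, x + y)"])
       (auto simp: quads_def algebra_simps h2[symmetric] dest!: less_imp_Suc_add)
  have 3: "sum ?g {q \<in> quads n. (case q of (a, b, x, y) \<Rightarrow> y) = (case q of (a, b, x, y) \<Rightarrow> x)} =
        (\<Sum>d | d dvd n. \<Sum>a=1..<d. g (of_nat a) (of_nat (d - a)))"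
    by (subst sum_quads_diagonal_xy[OF n, symmetric]) (auto intro!: sum.cong)
  have 4: "sum ?h {q \<in> quads n. (case q of (a, b, x, y) \<Rightarrow> a) = (case q of (a, b, x, y) \<Rightarrow> b)} =
        (\<Sum>d | d dvd n. of_nat (n div d - 1) * g (of_nat d) (- of_nat d))"
    by (subst sum_quads_diagonal_ab[OF n, symmetric]) (auto intro!: sum.cong)
  note 5 = sum_quads_trichotomy[of ?g n "\<lambda>(a, b, x, y). y" "\<lambda>(a, b, x, y). x", unfolded 1 2 3]
  note 6 = sum_quads_trichotomy[of ?h n "\<lambda>(a, b, x, y). a" "\<lambda>(a, b, x, y). b", unfolded 4]
  have "sum ?g (quads n) - sum ?h (quads n) =
      (\<Sum>d | d dvd n. \<Sum>a=1..<d. g (of_nat a) (of_nat (d - a)))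
      - (\<Sum>d | d dvd n. of_nat (n div d - 1) * g (of_nat d) (- of_nat d))"
    unfolding 5 6 by (simp only: add_diff_cancel_left)
  then show ?thesis
    by (simp add: sum_subtractf case_prod_unfold)
qed

subsection \<open>Convolution identities for divisor sums\<close>

text \<open>Faulhaber's formulas with denominators cleared, so that each induction step is a
  polynomial identity.\<close>

lemma sum_power_lessThan:
  fixes d :: nat
  defines "D \<equiv> of_nat d :: 'a :: field_char_0"
  shows "2 * (\<Sum>a<d. of_nat a) = D * (D - 1)"
    and "6 * (\<Sum>a<d. of_nat a ^ 2) = D * (D - 1) * (2 * D - 1)"
    and "4 * (\<Sum>a<d. of_nat a ^ 3) = D ^ 2 * (D - 1) ^ 2"
    and "30 * (\<Sum>a<d. of_nat a ^ 4) = D * (D - 1) * (2 * D - 1) * (3 * D ^ 2 - 3 * D - 1)"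
    and "12 * (\<Sum>a<d. of_nat a ^ 5) = D ^ 2 * (D - 1) ^ 2 * (2 * D ^ 2 - 2 * D - 1)"
    and "42 * (\<Sum>a<d. of_nat a ^ 6) = D * (D - 1) * (2 * D - 1) * (3 * D ^ 4 - 6 * D ^ 3 + 3 * D + 1)"
  unfolding D_def by - ((induct d; simp add: distrib_left; simp add: algebra_simps eval_nat_numeral)+)

text \<open>These are the inner sums over the diagonal \<open>x = y\<close>: for
  \<open>b = D - a\<close> the invariants \<open>a^2 + a b + b^2\<close> and
  \<open>(a b (a + b))^2\<close> become the summands shown.\<close>

lemma sum_norm_form:
  fixes d :: nat
  defines "D \<equiv> of_nat d :: 'a :: field_char_0"
  shows "6 * (\<Sum>a<d. D ^ 2 - of_nat a * D + of_nat a ^ 2) = 5 * D ^ 3 + D"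
    and "30 * (\<Sum>a<d. (D ^ 2 - of_nat a * D + of_nat a ^ 2) ^ 2) = 21 * D ^ 5 + 10 * D ^ 3 - D"
    and "420 * (\<Sum>a<d. (D ^ 2 - of_nat a * D + of_nat a ^ 2) ^ 3) =
           249 * D ^ 7 + 210 * D ^ 5 - 49 * D ^ 3 + 10 * D"
    and "30 * (\<Sum>a<d. (of_nat a * (D - of_nat a) * D) ^ 2) = D ^ 7 - D ^ 3"
proof -
  \<comment> \<open>With the power sums named, each claim is linear in them and follows from the
    closed forms. The exponent 1 is kept here and in the expansions below so that the linear terms
    match \<open>s1\<close> syntactically.\<close>
  define s1 where "s1 = (\<Sum>a<d. of_nat a ^ 1 :: 'a)"
  define s2 where "s2 = (\<Sum>a<d. of_nat a ^ 2 :: 'a)"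
  define s3 where "s3 = (\<Sum>a<d. of_nat a ^ 3 :: 'a)"
  define s4 where "s4 = (\<Sum>a<d. of_nat a ^ 4 :: 'a)"
  define s5 where "s5 = (\<Sum>a<d. of_nat a ^ 5 :: 'a)"
  define s6 where "s6 = (\<Sum>a<d. of_nat a ^ 6 :: 'a)"
  note s_def = s1_def s2_def s3_def s4_def s5_def s6_def
  have s: "2 * s1 = D * (D - 1)" "6 * s2 = D * (D - 1) * (2 * D - 1)"
    "4 * s3 = D ^ 2 * (D - 1) ^ 2"
    "30 * s4 = D * (D - 1) * (2 * D - 1) * (3 * D ^ 2 - 3 * D - 1)"
    "12 * s5 = D ^ 2 * (D - 1) ^ 2 * (2 * D ^ 2 - 2 * D - 1)"
    "42 * s6 = D * (D - 1) * (2 * D - 1) * (3 * D ^ 4 - 6 * D ^ 3 + 3 * D + 1)"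
    using sum_power_lessThan[of d, where ?'a = 'a] by (simp_all add: s_def D_def)
  have "(\<Sum>a<d. D ^ 2 - of_nat a * D + of_nat a ^ 2) = D * D ^ 2 - s1 * D + s2"
    by (simp add: s_def D_def sum.distrib sum_subtractf sum_distrib_right)
  then show "6 * (\<Sum>a<d. D ^ 2 - of_nat a * D + of_nat a ^ 2) = 5 * D ^ 3 + D"
    using s(1,2) by algebra
  have "(x ^ 2 - y * x + y ^ 2) ^ 2 = x ^ 4 - y ^ 1 * (2 * x ^ 3) + y ^ 2 * (3 * x ^ 2)
      - y ^ 3 * (2 * x) + y ^ 4" for x y :: 'a
    by algebra
  then have "(\<Sum>a<d. (D ^ 2 - of_nat a * D + of_nat a ^ 2) ^ 2) =
      D * D ^ 4 - s1 * (2 * D ^ 3) + s2 * (3 * D ^ 2) - s3 * (2 * D) + s4"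
    by (simp only: s_def sum.distrib sum_subtractf sum_distrib_right) (simp add: D_def)
  then show "30 * (\<Sum>a<d. (D ^ 2 - of_nat a * D + of_nat a ^ 2) ^ 2) = 21 * D ^ 5 + 10 * D ^ 3 - D"
    using s(1-4) by algebra
  have "(x ^ 2 - y * x + y ^ 2) ^ 3 = x ^ 6 - y ^ 1 * (3 * x ^ 5) + y ^ 2 * (6 * x ^ 4)
      - y ^ 3 * (7 * x ^ 3) + y ^ 4 * (6 * x ^ 2) - y ^ 5 * (3 * x) + y ^ 6" for x y :: 'a
    by algebra
  then have "(\<Sum>a<d. (D ^ 2 - of_nat a * D + of_nat a ^ 2) ^ 3) =
      D * D ^ 6 - s1 * (3 * D ^ 5) + s2 * (6 * D ^ 4) - s3 * (7 * D ^ 3) + s4 * (6 * D ^ 2)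
        - s5 * (3 * D) + s6"
    by (simp only: s_def sum.distrib sum_subtractf sum_distrib_right) (simp add: D_def)
  then show "420 * (\<Sum>a<d. (D ^ 2 - of_nat a * D + of_nat a ^ 2) ^ 3) =
           249 * D ^ 7 + 210 * D ^ 5 - 49 * D ^ 3 + 10 * D"
    using s by algebra
  have "(y * (x - y) * x) ^ 2 = y ^ 2 * x ^ 4 - y ^ 3 * (2 * x ^ 3) + y ^ 4 * x ^ 2" for x y :: 'a
    by algebra
  then have "(\<Sum>a<d. (of_nat a * (D - of_nat a) * D) ^ 2) =
      s2 * D ^ 4 - s3 * (2 * D ^ 3) + s4 * D ^ 2"
    by (simp only: s_def sum.distrib sum_subtractf sum_distrib_right)
  then show "30 * (\<Sum>a<d. (of_nat a * (D - of_nat a) * D) ^ 2) = D ^ 7 - D ^ 3"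
    using s(2-4) by algebra
qed

lemma sum_divisors_power:
  "(\<Sum>d | d dvd n. of_nat d ^ k :: 'a :: comm_semiring_1) = of_nat (divisor_sigma k n)"
  by (simp add: divisor_sigma_def)

text \<open>Two adjustments make the right side polynomial in \<open>n\<close> and \<open>d\<close>.
  The inner sum starts at \<open>a = 0\<close>, at the cost of the term \<open>g 0 d\<close>, and
  the factor \<open>d\<close> taken out of \<open>g d (- d)\<close> absorbs the quotient:
  \<open>(n div d - 1) * d = n - d\<close>.\<close>

lemma sum_quads_symmetric_lessThan:
  fixes g :: "'a :: field_char_0 \<Rightarrow> 'a \<Rightarrow> 'a"
  assumes n: "0 < n"
    and comm: "\<And>a b. g a b = g b a"
    and third: "\<And>a b. g a b = g a (- a - b)"
    and even: "\<And>a b. g (- a) (- b) = g a b"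
    and e: "\<And>a. g a (- a) = a * e a"
  shows "(\<Sum>(a, b, x, y)\<in>quads n. g (of_nat a) (of_nat b) - g (of_nat a) (- of_nat b)) =
         (\<Sum>d | d dvd n. (\<Sum>a<d. g (of_nat a) (of_nat d - of_nat a)) - g 0 (of_nat d)
            - (of_nat n - of_nat d) * e (of_nat d))"
  unfolding sum_quads_symmetric[OF n comm third even]
proof (rule sum.cong)
  fix d assume "d \<in> {d. d dvd n}"
  with n obtain k where k: "n = d * k" "0 < k" "0 < d"
    by (auto elim!: dvdE)
  have "(\<Sum>a<d. g (of_nat a) (of_nat d - of_nat a)) =
      (\<Sum>a\<in>insert 0 {1..<d}. g (of_nat a) (of_nat d - of_nat a))"
    using k by (intro sum.cong) auto
  also have "\<dots> = g 0 (of_nat d) + (\<Sum>a=1..<d. g (of_nat a) (of_nat (d - a)))"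
    by (simp add: of_nat_diff)
  finally show "(\<Sum>a=1..<d. g (of_nat a) (of_nat (d - a))) - of_nat (n div d - 1) * g (of_nat d) (- of_nat d) =
      (\<Sum>a<d. g (of_nat a) (of_nat d - of_nat a)) - g 0 (of_nat d) - (of_nat n - of_nat d) * e (of_nat d)"
    using k by (simp add: e of_nat_diff algebra_simps)
qed simp

text \<open>The choices of \<open>g\<close> below are polynomials in the two basic invariants \<open>a\<^sup>2 + a b + b\<^sup>2\<close> and
  \<open>(a b (a + b))\<^sup>2\<close> of the symmetric group permuting \<open>a, b, - a - b\<close>.\<close>

lemma divisor_sigma_convolutions:
  fixes n :: nat
  defines "S \<equiv> \<lambda>j k. \<Sum>i=0..n. of_nat (divisor_sigma j i) * of_nat (divisor_sigma k (n - i)) :: 'a :: field_char_0"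
    and "\<sigma> \<equiv> \<lambda>k. of_nat (divisor_sigma k n)"
  assumes n: "0 < n"
  shows "12 * S 1 1 = 5 * \<sigma> 3 + \<sigma> 1 - 6 * of_nat n * \<sigma> 1"
    and "240 * S 1 3 = 21 * \<sigma> 5 + 10 * \<sigma> 3 - \<sigma> 1 - 30 * of_nat n * \<sigma> 3"
    and "120 * S 3 3 = \<sigma> 7 - \<sigma> 3"
    and "504 * S 1 5 = 20 * \<sigma> 7 + 21 * \<sigma> 5 + \<sigma> 1 - 42 * of_nat n * \<sigma> 5"
proof -
  define t where "t j k = (\<lambda>(a, b, x :: nat, y :: nat). of_nat a ^ j * of_nat b ^ k :: 'a)" for j k
  have S: "sum (t j k) (quads n) = S j k" for j k
    unfolding S_def t_def using arg_cong[OF divisor_sigma_convolution[where j = j and k = k and n = n], of "of_nat :: nat \<Rightarrow> 'a"]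
    by (simp add: case_prod_unfold)
  have S_comm: "S j k = S k j" for j k
    unfolding S[symmetric] t_def
    by (subst sum_quads_swap[where f = "\<lambda>a b. of_nat a ^ j * of_nat b ^ k"]) (simp add: mult.commute)
  note \<sigma> = sum_divisors_power[of _ n, where ?'a = 'a]
  define N :: 'a where "N = of_nat n"

  let ?q = "\<lambda>a b. a ^ 2 + a * b + b ^ 2 :: 'a"
  have q: "?q a (b - a) = b ^ 2 - a * b + a ^ 2" for a b
    by algebra

  have "12 * S 1 1 = 6 * (\<Sum>(a, b, x, y)\<in>quads n. ?q (of_nat a) (of_nat b) - ?q (of_nat a) (- of_nat b))"
  proof -
    have "?q a b - ?q a (- b) = 2 * (a ^ 1 * b ^ 1)" for a b
      by algebra
    then show ?thesis
      by (simp only: sum_distrib_left S[symmetric] t_def) (simp add: case_prod_unfold)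
  qed
  \<comment> \<open>The choice of \<open>e\<close> comes from
    \<open>?q a (- a) = a ^ 2 = a * a\<close>. For the square and the cube of \<open>?q\<close> the
    same value gives \<open>a ^ 3\<close> and \<open>a ^ 5\<close>.\<close>
  also have "\<dots> = (\<Sum>d | d dvd n. 5 * of_nat d ^ 3 + of_nat d ^ 1 - 6 * N * of_nat d ^ 1)"
  proof (subst sum_quads_symmetric_lessThan[OF n, where e = "\<lambda>a. a"], goal_cases)
    case 5
    have "6 * (T - ?q 0 D - (N - D) * D) = 5 * D ^ 3 + D ^ 1 - 6 * N * D ^ 1"
      if "6 * T = 5 * D ^ 3 + D" for T D
      using that by (simp add: algebra_simps eval_nat_numeral)
    from this[OF sum_norm_form(1)] show ?case
      by (simp only: sum_distrib_left q N_def)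
  qed algebra+
  finally show "12 * S 1 1 = 5 * \<sigma> 3 + \<sigma> 1 - 6 * of_nat n * \<sigma> 1"
    by (simp only: sum.distrib sum_subtractf sum_distrib_left[symmetric] \<sigma> \<sigma>_def N_def)

  have "240 * S 1 3 = 30 * (\<Sum>(a, b, x, y)\<in>quads n. ?q (of_nat a) (of_nat b) ^ 2 - ?q (of_nat a) (- of_nat b) ^ 2)"
  proof -
    have "?q a b ^ 2 - ?q a (- b) ^ 2 = 4 * (a ^ 1 * b ^ 3) + 4 * (a ^ 3 * b ^ 1)" for a b
      by algebra
    then have "(\<Sum>(a, b, x, y)\<in>quads n. ?q (of_nat a) (of_nat b) ^ 2 - ?q (of_nat a) (- of_nat b) ^ 2)
        = 4 * S 1 3 + 4 * S 3 1"
      by (simp only: sum_distrib_left S[symmetric] t_def sum.distrib[symmetric])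
         (simp add: case_prod_unfold)
    then show ?thesis
      using S_comm[of 3 1] by simp
  qed
  also have "\<dots> = (\<Sum>d | d dvd n. 21 * of_nat d ^ 5 + 10 * of_nat d ^ 3 - of_nat d ^ 1 - 30 * N * of_nat d ^ 3)"
  proof (subst sum_quads_symmetric_lessThan[OF n, where e = "\<lambda>a. a ^ 3"], goal_cases)
    case 5
    have "30 * (T - ?q 0 D ^ 2 - (N - D) * D ^ 3) = 21 * D ^ 5 + 10 * D ^ 3 - D ^ 1 - 30 * N * D ^ 3"
      if "30 * T = 21 * D ^ 5 + 10 * D ^ 3 - D" for T D
      using that by (simp add: algebra_simps eval_nat_numeral)
    from this[OF sum_norm_form(2)] show ?case
      by (simp only: sum_distrib_left q N_def)
  qed algebra+
  finally show "240 * S 1 3 = 21 * \<sigma> 5 + 10 * \<sigma> 3 - \<sigma> 1 - 30 * of_nat n * \<sigma> 3"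
    by (simp only: sum.distrib sum_subtractf sum_distrib_left[symmetric] \<sigma> \<sigma>_def N_def)

  let ?r = "\<lambda>a b. (a * b * (a + b)) ^ 2 :: 'a"
  have r: "?r a (b - a) = (a * (b - a) * b) ^ 2" for a b
    by algebra
  have "120 * S 3 3 = 30 * (\<Sum>(a, b, x, y)\<in>quads n. ?r (of_nat a) (of_nat b) - ?r (of_nat a) (- of_nat b))"
  proof -
    have "?r a b - ?r a (- b) = 4 * (a ^ 3 * b ^ 3)" for a b
      by algebra
    then show ?thesis
      by (simp only: sum_distrib_left S[symmetric] t_def) (simp add: case_prod_unfold)
  qed
  \<comment> \<open>Here \<open>?r a (- a) = 0\<close>, so the diagonal \<open>a = b\<close>
    contributes nothing and no term in \<open>n\<close> appears.\<close>
  also have "\<dots> = (\<Sum>d | d dvd n. of_nat d ^ 7 - of_nat d ^ 3)"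
  proof (subst sum_quads_symmetric_lessThan[OF n, where e = "\<lambda>a. 0"], goal_cases)
    case 5
    have "30 * (T - ?r 0 D - (N - D) * 0) = D ^ 7 - D ^ 3"
      if "30 * T = D ^ 7 - D ^ 3" for T D
      using that by (simp add: algebra_simps eval_nat_numeral)
    from this[OF sum_norm_form(4)] show ?case
      by (simp only: sum_distrib_left r N_def)
  qed (simp | algebra)+
  finally show S33: "120 * S 3 3 = \<sigma> 7 - \<sigma> 3"
    by (simp only: sum.distrib sum_subtractf sum_distrib_left[symmetric] \<sigma> \<sigma>_def N_def)

  \<comment> \<open>The cube of \<open>?q\<close> also produces \<open>a ^ 3 * b ^ 3\<close>. This
    part is eliminated afterwards with \<open>S33\<close>, since
    \<open>420 * 14 = 49 * 120\<close>.\<close>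
  have "420 * (12 * S 1 5 + 14 * S 3 3) =
      420 * (\<Sum>(a, b, x, y)\<in>quads n. ?q (of_nat a) (of_nat b) ^ 3 - ?q (of_nat a) (- of_nat b) ^ 3)"
  proof -
    have "?q a b ^ 3 - ?q a (- b) ^ 3 = 6 * (a ^ 1 * b ^ 5) + 6 * (a ^ 5 * b ^ 1) + 14 * (a ^ 3 * b ^ 3)"
      for a b
      by algebra
    then have "(\<Sum>(a, b, x, y)\<in>quads n. ?q (of_nat a) (of_nat b) ^ 3 - ?q (of_nat a) (- of_nat b) ^ 3)
        = 6 * S 1 5 + 6 * S 5 1 + 14 * S 3 3"
      by (simp only: sum_distrib_left S[symmetric] t_def sum.distrib[symmetric])
         (simp add: case_prod_unfold)
    then show ?thesis
      using S_comm[of 5 1] by simp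
  qed
  also have "\<dots> = (\<Sum>d | d dvd n. 249 * of_nat d ^ 7 + 210 * of_nat d ^ 5 - 49 * of_nat d ^ 3
      + 10 * of_nat d ^ 1 - 420 * N * of_nat d ^ 5)"
  proof (subst sum_quads_symmetric_lessThan[OF n, where e = "\<lambda>a. a ^ 5"], goal_cases)
    case 5
    have "420 * (T - ?q 0 D ^ 3 - (N - D) * D ^ 5) =
        249 * D ^ 7 + 210 * D ^ 5 - 49 * D ^ 3 + 10 * D ^ 1 - 420 * N * D ^ 5"
      if "420 * T = 249 * D ^ 7 + 210 * D ^ 5 - 49 * D ^ 3 + 10 * D" for T D
      using that by (simp add: algebra_simps eval_nat_numeral)
    from this[OF sum_norm_form(3)] show ?case
      by (simp only: sum_distrib_left q N_def)
  qed algebra+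
  finally have 420: "420 * (12 * S 1 5 + 14 * S 3 3) =
      249 * \<sigma> 7 + 210 * \<sigma> 5 - 49 * \<sigma> 3 + 10 * \<sigma> 1 - 420 * of_nat n * \<sigma> 5"
    by (simp only: sum.distrib sum_subtractf sum_distrib_left[symmetric] \<sigma> \<sigma>_def N_def)
  have "10 * (504 * S 1 5) = 420 * (12 * S 1 5 + 14 * S 3 3) - 49 * (120 * S 3 3)"
    by (simp add: algebra_simps)
  also have "\<dots> = 10 * (20 * \<sigma> 7 + 21 * \<sigma> 5 + \<sigma> 1 - 42 * of_nat n * \<sigma> 5)"
    unfolding 420 S33 by (simp add: algebra_simps)
  finally show "504 * S 1 5 = 20 * \<sigma> 7 + 21 * \<sigma> 5 + \<sigma> 1 - 42 * of_nat n * \<sigma> 5"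
    by (simp only: mult_cancel_left) simp
qed

subsection \<open>Ramanujan's differential equations\<close>

definition sigma_fps :: "nat \<Rightarrow> complex fps" where
  "sigma_fps k = Abs_fps (\<lambda>n. of_nat (divisor_sigma k n))"

text \<open>The operator \<open>q d/dq\<close>, which is the operator \<open>D\<close> of the
  introduction when \<open>q = exp (2 \<pi> \<i> z)\<close>.\<close>

definition fps_theta :: "'a :: comm_semiring_1 fps \<Rightarrow> 'a fps" where
  "fps_theta F = fps_X * fps_deriv F"

definition E2_fps :: "complex fps" where "E2_fps = 1 - 24 * sigma_fps 1"

definition E4_fps :: "complex fps" where "E4_fps = 1 + 240 * sigma_fps 3"

definition E6_fps :: "complex fps" where "E6_fps = 1 - 504 * sigma_fps 5"

lemma fps_nth_theta [simp]: "fps_nth (fps_theta F) n = of_nat n * fps_nth F n"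
  by (cases n) (simp_all add: fps_theta_def)

text \<open>Compare coefficients: a factor \<open>n\<close> in the convolution identities becomes
  \<open>fps_theta\<close>. Those identities assume \<open>0 < n\<close>, so the constant terms are
  checked separately; they all vanish.\<close>

lemma sigma_fps_products:
  "12 * sigma_fps 1 ^ 2 = 5 * sigma_fps 3 + sigma_fps 1 - 6 * fps_theta (sigma_fps 1)"
  "240 * (sigma_fps 1 * sigma_fps 3) =
     21 * sigma_fps 5 + 10 * sigma_fps 3 - sigma_fps 1 - 30 * fps_theta (sigma_fps 3)"
  "120 * sigma_fps 3 ^ 2 = sigma_fps 7 - sigma_fps 3"
  "504 * (sigma_fps 1 * sigma_fps 5) =
     20 * sigma_fps 7 + 21 * sigma_fps 5 + sigma_fps 1 - 42 * fps_theta (sigma_fps 5)"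
proof -
  have coeff: "F = G" if "fps_nth F 0 = fps_nth G 0" "\<And>n. 0 < n \<Longrightarrow> fps_nth F n = fps_nth G n"
    for F G :: "complex fps"
    using that by (metis fps_ext neq0_conv)
  have nth: "fps_nth (sigma_fps k) n = of_nat (divisor_sigma k n)" for k n
    by (simp add: sigma_fps_def)
  have nth_mult: "fps_nth (sigma_fps j * sigma_fps k) n =
      (\<Sum>i=0..n. of_nat (divisor_sigma j i) * of_nat (divisor_sigma k (n - i)))" for j k n
    by (simp add: fps_mult_nth nth)
  note simps = nth nth_mult power2_eq_square mult.assoc
  show "12 * sigma_fps 1 ^ 2 = 5 * sigma_fps 3 + sigma_fps 1 - 6 * fps_theta (sigma_fps 1)"
    by (rule coeff) (use divisor_sigma_convolutions(1)[where ?'a = complex] in \<open>simp_all add: simps\<close>)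
  show "240 * (sigma_fps 1 * sigma_fps 3) =
     21 * sigma_fps 5 + 10 * sigma_fps 3 - sigma_fps 1 - 30 * fps_theta (sigma_fps 3)"
    by (rule coeff) (use divisor_sigma_convolutions(2)[where ?'a = complex] in \<open>simp_all add: simps\<close>)
  show "120 * sigma_fps 3 ^ 2 = sigma_fps 7 - sigma_fps 3"
    by (rule coeff) (use divisor_sigma_convolutions(3)[where ?'a = complex] in \<open>simp_all add: simps\<close>)
  show "504 * (sigma_fps 1 * sigma_fps 5) =
     20 * sigma_fps 7 + 21 * sigma_fps 5 + sigma_fps 1 - 42 * fps_theta (sigma_fps 5)"
    by (rule coeff) (use divisor_sigma_convolutions(4)[where ?'a = complex] in \<open>simp_all add: simps\<close>)
qed

text \<open>The first two equations each expand one product formula. For the third,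
  \<open>sigma_fps 7\<close> is eliminated between the formulas for \<open>sigma_fps 3 ^ 2\<close>
  and \<open>sigma_fps 1 * sigma_fps 5\<close>.\<close>

lemma ramanujan_fps:
  "12 * fps_theta E2_fps = E2_fps ^ 2 - E4_fps"
  "3 * fps_theta E4_fps = E2_fps * E4_fps - E6_fps"
  "2 * fps_theta E6_fps = E2_fps * E6_fps - E4_fps ^ 2"
proof -
  have theta: "fps_theta E2_fps = - 24 * fps_theta (sigma_fps 1)"
      "fps_theta E4_fps = 240 * fps_theta (sigma_fps 3)"
      "fps_theta E6_fps = - 504 * fps_theta (sigma_fps 5)"
    by (simp_all add: E2_fps_def E4_fps_def E6_fps_def fps_theta_def)
  define s1 where "s1 = sigma_fps 1"
  define s3 where "s3 = sigma_fps 3"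
  define s5 where "s5 = sigma_fps 5"
  define s7 where "s7 = sigma_fps 7"
  define t1 where "t1 = fps_theta (sigma_fps 1)"
  define t3 where "t3 = fps_theta (sigma_fps 3)"
  define t5 where "t5 = fps_theta (sigma_fps 5)"
  note defs = s1_def[symmetric] s3_def[symmetric] s5_def[symmetric] s7_def[symmetric]
    t1_def[symmetric] t3_def[symmetric] t5_def[symmetric]
  note prods = sigma_fps_products[unfolded defs]
  show "12 * fps_theta E2_fps = E2_fps ^ 2 - E4_fps"
    unfolding theta unfolding E2_fps_def E4_fps_def defs using prods(1) by algebra
  show "3 * fps_theta E4_fps = E2_fps * E4_fps - E6_fps"
    unfolding theta unfolding E2_fps_def E4_fps_def E6_fps_def defs using prods(2) by algebra
  show "2 * fps_theta E6_fps = E2_fps * E6_fps - E4_fps ^ 2"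
    unfolding theta unfolding E2_fps_def E4_fps_def E6_fps_def defs using prods(3,4) by algebra
qed

section \<open>Convergence of the divisor series on the unit disc\<close>

lemma divisor_sigma_le: "divisor_sigma k n \<le> n ^ Suc k"
proof (cases "n = 0")
  case False
  have "divisor_sigma k n \<le> (\<Sum>d\<in>{1..n}. n ^ k)"
    unfolding divisor_sigma_def using False
    by (intro order_trans[OF sum_mono sum_mono2] power_mono)
       (auto intro: dvd_imp_le dest: dvd_pos_nat simp: Suc_le_eq)
  then show ?thesis by simp
qed simp

text \<open>The coefficients are bounded by \<open>(n + 1) ^ (k + 1)\<close>, and the series with
  these coefficients has radius 1 by the ratio test.\<close>

lemma conv_radius_sigma_fps: "1 \<le> fps_conv_radius (sigma_fps k)"
proof -
  let ?g = "\<lambda>n. of_nat (Suc n) ^ Suc k :: real"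
  have "(\<lambda>n. (real (Suc n) / real (Suc (Suc n))) ^ Suc k) \<longlonglongrightarrow> 1 ^ Suc k"
    by (intro tendsto_power) real_asymp
  then have radius: "conv_radius ?g = 1"
    by (intro conv_radius_ratio_limit_nonzero[of _ 1])
       (simp_all add: norm_power power_divide norm_mult flip: power_Suc del: of_nat_Suc)
  show ?thesis
    unfolding fps_conv_radius_def
  proof (rule conv_radius_geI_ex')
    fix r :: real assume r: "0 < r" "ereal r < 1"
    then have "summable (\<lambda>n. ?g n * r ^ n)"
      by (intro summable_in_conv_radius, subst radius) simp
    then show "summable (\<lambda>n. fps_nth (sigma_fps k) n * of_real r ^ n)"
    proof (rule summable_comparison_test'[where N = 0])
      fix n :: nat
      have "real (divisor_sigma k n) \<le> real (n ^ Suc k)"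
        using divisor_sigma_le of_nat_le_iff by blast
      also have "\<dots> \<le> ?g n"
        by (simp add: power_mono del: power_Suc)
      finally show "norm (fps_nth (sigma_fps k) n * of_real r ^ n) \<le> ?g n * r ^ n"
        using r by (simp add: sigma_fps_def norm_mult norm_power mult_right_mono)
    qed
  qed
qed

subsection \<open>The Schwarz derivative\<close>

text \<open>Ramanujan's equations make the polynomials in \<open>P\<close>, \<open>Q\<close>,
  \<open>R\<close> closed under differentiation, so everything reduces to rational functions of
  them. The two conditions in \<open>nz\<close> keep the denominators of \<open>f\<close> and of
  \<open>f'' / f'\<close> away from 0.\<close>

lemma schwarz_deriv_of_ramanujan:
  fixes c :: complex and P Q R f :: "complex \<Rightarrow> complex"
  assumes "open S" "c \<noteq> 0"
    and dP: "\<And>z. z \<in> S \<Longrightarrow> (P has_field_derivative c * ((P z ^ 2 - Q z) / 12)) (at z)"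
    and dQ: "\<And>z. z \<in> S \<Longrightarrow> (Q has_field_derivative c * ((P z * Q z - R z) / 3)) (at z)"
    and dR: "\<And>z. z \<in> S \<Longrightarrow> (R has_field_derivative c * ((P z * R z - Q z ^ 2) / 2)) (at z)"
    and f: "\<And>z. z \<in> S \<Longrightarrow> f z = z + 4 * (Q z / deriv Q z)"
    and nz: "\<And>z. z \<in> S \<Longrightarrow> P z * Q z - R z \<noteq> 0" "\<And>z. z \<in> S \<Longrightarrow> Q z ^ 3 - R z ^ 2 \<noteq> 0"
    and z: "z \<in> S"
  shows "schwarz_deriv f z = - (c ^ 2) * Q z"
proof -
  \<comment> \<open>For \<open>D = c^-1 d/dz\<close> these are \<open>D Q\<close>,
    \<open>D N\<close> and \<open>D N1\<close>. Writing \<open>N2\<close> as a combination of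
    \<open>N1\<close> and \<open>N\<close> removes \<open>R\<close> from the final identity.\<close>
  define N where "N = (\<lambda>z. (P z * Q z - R z) / 3)"
  define N1 where "N1 = (\<lambda>z. 5 / 36 * (P z ^ 2 * Q z + Q z ^ 2 - 2 * P z * R z))"
  define N2 where "N2 = (\<lambda>z. P z * N1 z + 5 / 24 * (Q z - P z ^ 2) * N z)"
  define \<Delta> where "\<Delta> = (\<lambda>z. Q z ^ 3 - R z ^ 2)"
  have nz': "N z \<noteq> 0" "\<Delta> z \<noteq> 0" if "z \<in> S" for z
    using nz[OF that] by (auto simp: N_def \<Delta>_def)
  have dN: "(N has_field_derivative c * N1 z) (at z)" if "z \<in> S" for z
    unfolding N_def
    by (rule derivative_eq_intros dP dQ dR that refl)+
       (unfold N1_def, simp, simp add: field_simps, simp add: power2_eq_square)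
  have dN1: "(N1 has_field_derivative c * N2 z) (at z)" if "z \<in> S" for z
    unfolding N1_def
    by (rule derivative_eq_intros dP dQ dR that refl)+
       (unfold N1_def N2_def N_def, simp, simp add: field_simps, simp add: eval_nat_numeral algebra_simps)
  have d\<Delta>: "(\<Delta> has_field_derivative c * P z * \<Delta> z) (at z)" if "z \<in> S" for z
    unfolding \<Delta>_def
    by (rule derivative_eq_intros dP dQ dR that refl)+
       (simp, simp add: field_simps, simp add: eval_nat_numeral algebra_simps)
  \<comment> \<open>The formula for \<open>f\<close> holds only on \<open>S\<close>; as
    \<open>S\<close> is open, derivatives of closed forms carry over to \<open>f\<close> and to the
    iterated derivatives.\<close>
  have deriv_cong: "(g has_field_derivative D) (at z)"
    if "(h has_field_derivative D) (at z)" "z \<in> S" "\<And>w. w \<in> S \<Longrightarrow> g w = h w" for g h D z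
    using that \<open>open S\<close> by (metis has_field_derivative_transform_within_open)
  have df: "(f has_field_derivative - 5 / 9 * (\<Delta> z / N z ^ 2)) (at z)" if "z \<in> S" for z
  proof (rule deriv_cong[OF _ that])
    show "f w = w + 4 * (Q w / (c * N w))" if "w \<in> S" for w
      using f[OF that] DERIV_imp_deriv[OF dQ[OF that]] by (simp add: N_def)
    have dQ': "(Q has_field_derivative c * N z) (at z)" if "z \<in> S" for z
      using dQ[OF that] by (simp add: N_def)
    have "1 + 4 * ((c * N z * (c * N z) - Q z * (c * (c * N1 z))) / (c * N z * (c * N z))) =
        - 5 / 9 * (\<Delta> z / N z ^ 2)"
    proof -
      \<comment> \<open>This is the numerator of \<open>f'\<close> over \<open>N z ^ 2\<close>; all
        terms containing \<open>P\<close> cancel.\<close>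
      have "5 * N z ^ 2 - 4 * (Q z * N1 z) = - 5 / 9 * \<Delta> z"
        unfolding N_def N1_def \<Delta>_def by (simp add: field_simps eval_nat_numeral)
      moreover have "1 + 4 * ((c * N z * (c * N z) - Q z * (c * (c * N1 z))) / (c * N z * (c * N z))) =
          (5 * N z ^ 2 - 4 * (Q z * N1 z)) / N z ^ 2"
        using nz'[OF that] \<open>c \<noteq> 0\<close> by (simp add: field_simps power2_eq_square)
      ultimately show ?thesis
        by simp
    qed
    moreover have "((\<lambda>w. w + 4 * (Q w / (c * N w))) has_field_derivative
        1 + 4 * ((c * N z * (c * N z) - Q z * (c * (c * N1 z))) / (c * N z * (c * N z)))) (at z)"
      using nz'[OF that] \<open>c \<noteq> 0\<close>
      by (auto intro!: derivative_eq_intros dQ' dN that simp: algebra_simps)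
    ultimately show "((\<lambda>w. w + 4 * (Q w / (c * N w))) has_field_derivative
        - 5 / 9 * (\<Delta> z / N z ^ 2)) (at z)"
      by simp
  qed
  have ddf: "(deriv f has_field_derivative - 5 / 9 * (c * (\<Delta> z * (P z - 2 * N1 z / N z) / N z ^ 2))) (at z)"
    if "z \<in> S" for z
  proof (rule deriv_cong[OF _ that])
    show "deriv f w = - 5 / 9 * (\<Delta> w / N w ^ 2)" if "w \<in> S" for w
      by (rule DERIV_imp_deriv) (rule df[OF that])
    show "((\<lambda>w. - 5 / 9 * (\<Delta> w / N w ^ 2)) has_field_derivative
        - 5 / 9 * (c * (\<Delta> z * (P z - 2 * N1 z / N z) / N z ^ 2))) (at z)"
      using nz'[OF that]
      by (auto intro!: derivative_eq_intros d\<Delta> dN that simp: field_simps eval_nat_numeral)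
  qed
  have quot: "deriv (deriv f) w / deriv f w = c * (P w - 2 * N1 w / N w)" if "w \<in> S" for w
    unfolding DERIV_imp_deriv[OF ddf[OF that]] DERIV_imp_deriv[OF df[OF that]]
    using nz'[OF that] by (simp add: divide_simps)
  have "((\<lambda>w. deriv (deriv f) w / deriv f w) has_field_derivative
      c ^ 2 * ((P z ^ 2 - Q z) / 12 - 2 * (N2 z * N z - N1 z ^ 2) / N z ^ 2)) (at z)"
  proof (rule deriv_cong[OF _ z quot])
    show "((\<lambda>w. c * (P w - 2 * N1 w / N w)) has_field_derivative
      c ^ 2 * ((P z ^ 2 - Q z) / 12 - 2 * (N2 z * N z - N1 z ^ 2) / N z ^ 2)) (at z)"
      using nz'[OF z]
      by (auto intro!: derivative_eq_intros dP dN dN1 z simp: field_simps eval_nat_numeral)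
  qed
  then have "schwarz_deriv f z = 2 * (c ^ 2 * ((P z ^ 2 - Q z) / 12 - 2 * (N2 z * N z - N1 z ^ 2) / N z ^ 2))
      - (c * (P z - 2 * N1 z / N z)) ^ 2"
    unfolding schwarz_deriv_def quot[OF z] by (simp add: DERIV_imp_deriv)
  \<comment> \<open>After expanding \<open>N2\<close>, the terms with \<open>N1\<close> cancel, then
    those with \<open>P z ^ 2\<close>.\<close>
  also have "\<dots> = - (c ^ 2) * Q z"
    using nz'[OF z] unfolding N2_def by (simp add: field_simps eval_nat_numeral)
  finally show ?thesis .
qed

subsection \<open>Evaluation on the upper half-plane\<close>

definition q_eval :: "complex fps \<Rightarrow> complex \<Rightarrow> complex" where
  "q_eval F z = eval_fps F (exp (2 * of_real pi * \<i> * z))"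

lemma norm_q_less_1: "Im z > 0 \<Longrightarrow> norm (exp (2 * of_real pi * \<i> * z)) < 1"
  by simp

lemma in_conv_radius:
  assumes "1 \<le> fps_conv_radius F" "norm w < 1"
  shows "ereal (norm w) < fps_conv_radius F"
  using assms by (metis ereal_less(3) less_le_trans less_ereal.simps(1) one_ereal_def)

lemma conv_radius_ge_1_arith:
  assumes "1 \<le> fps_conv_radius F" "1 \<le> fps_conv_radius G"
  shows "1 \<le> fps_conv_radius (F + G)" "1 \<le> fps_conv_radius (F - G)" "1 \<le> fps_conv_radius (F * G)"
  using assms order_trans[OF _ fps_conv_radius_add[of F G], of 1]
    order_trans[OF _ fps_conv_radius_diff[of F G], of 1]
    order_trans[OF _ fps_conv_radius_mult[of F G], of 1]
  by auto

lemma conv_radius_ge_1_power: "1 \<le> fps_conv_radius F \<Longrightarrow> 1 \<le> fps_conv_radius (F ^ k)"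
  by (rule order_trans[OF _ fps_conv_radius_power])

lemma conv_radius_eisenstein:
  "1 \<le> fps_conv_radius E2_fps" "1 \<le> fps_conv_radius E4_fps" "1 \<le> fps_conv_radius E6_fps"
  unfolding E2_fps_def E4_fps_def E6_fps_def
  by (intro conv_radius_ge_1_arith conv_radius_sigma_fps; simp)+

lemma q_eval_arith:
  assumes "1 \<le> fps_conv_radius F" "1 \<le> fps_conv_radius G" "Im z > 0"
  shows "q_eval (F + G) z = q_eval F z + q_eval G z"
    and "q_eval (F - G) z = q_eval F z - q_eval G z"
    and "q_eval (F * G) z = q_eval F z * q_eval G z"
  unfolding q_eval_def
  by (intro eval_fps_add eval_fps_diff eval_fps_mult in_conv_radius norm_q_less_1 assms)+

lemma q_eval_power:
  assumes "1 \<le> fps_conv_radius F" "Im z > 0"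
  shows "q_eval (F ^ k) z = q_eval F z ^ k"
  unfolding q_eval_def by (intro eval_fps_power in_conv_radius norm_q_less_1 assms)

lemma q_eval_numeral: "q_eval (numeral m) z = numeral m"
  by (simp add: q_eval_def)

text \<open>By the chain rule the exponential contributes \<open>2 \<pi> \<i> q\<close>, and its
  factor \<open>q\<close> turns \<open>fps_deriv\<close> into \<open>fps_theta\<close>.\<close>

lemma has_field_derivative_q_eval:
  assumes "1 \<le> fps_conv_radius F" "Im z > 0"
  shows "(q_eval F has_field_derivative 2 * of_real pi * \<i> * q_eval (fps_theta F) z) (at z)"
proof -
  define w where "w = exp (2 * of_real pi * \<i> * z)"
  have w: "ereal (norm w) < fps_conv_radius F"
    unfolding w_def by (intro in_conv_radius norm_q_less_1 assms)
  then have "eval_fps (fps_theta F) w = w * eval_fps (fps_deriv F) w"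
    unfolding fps_theta_def
    by (subst eval_fps_mult) (auto intro: less_le_trans[OF _ fps_conv_radius_deriv])
  moreover have "((\<lambda>z. eval_fps F (exp (2 * of_real pi * \<i> * z))) has_field_derivative
      eval_fps (fps_deriv F) w * (w * (2 * of_real pi * \<i>))) (at z)"
    using w unfolding w_def
    by (intro DERIV_chain2[where f = "eval_fps F"] has_field_derivative_eval_fps)
       (auto intro!: derivative_eq_intros)
  ultimately show ?thesis
    by (simp add: q_eval_def[abs_def] w_def mult_ac)
qed

lemma holomorphic_q_eval:
  assumes "1 \<le> fps_conv_radius F"
  shows "q_eval F holomorphic_on upper_half_plane"
  using has_field_derivative_q_eval[OF assms]
  by (auto simp: holomorphic_on_open open_halfspace_Im_gt)

lemma E4_conv_q_eval:
  assumes "Im z > 0"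
  shows "E4 z = q_eval E4_fps z"
proof -
  define w where "w = exp (2 * of_real pi * \<i> * z)"
  have w: "ereal (norm w) < fps_conv_radius (sigma_fps 3)"
    unfolding w_def by (intro in_conv_radius norm_q_less_1 assms conv_radius_sigma_fps)
  have "exp (2 * of_real pi * \<i> * of_nat (Suc n) * z) = w ^ Suc n" for n
    unfolding w_def exp_of_nat_mult[symmetric] by (simp add: mult_ac)
  then have "E4 z = 1 + 240 * (\<Sum>n. fps_nth (sigma_fps 3) (Suc n) * w ^ Suc n)"
    by (simp add: E4_def sigma_fps_def sigma3_def divisor_sigma_def)
  \<comment> \<open>The constant coefficient is 0, so the shifted series has the same sum as the
    full one.\<close>
  also have "(\<Sum>n. fps_nth (sigma_fps 3) (Suc n) * w ^ Suc n) = eval_fps (sigma_fps 3) w"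
    unfolding eval_fps_def
    by (subst suminf_split_head[OF summable_fps[OF w]]) (simp add: sigma_fps_def)
  also have "1 + 240 * eval_fps (sigma_fps 3) w = eval_fps E4_fps w"
  proof -
    have "ereal (norm w) < fps_conv_radius (240 * sigma_fps 3)"
      unfolding w_def
      by (intro in_conv_radius norm_q_less_1 assms conv_radius_ge_1_arith conv_radius_sigma_fps) simp
    with w show ?thesis
      by (simp add: E4_fps_def eval_fps_add eval_fps_mult)
  qed
  also have "\<dots> = q_eval E4_fps z"
    by (simp add: q_eval_def w_def)
  finally show ?thesis .
qed

text \<open>The exponential maps the half-plane onto the punctured disc, so a series vanishing identically
  on the half-plane vanishes on the disc once it is multiplied by the variable.\<close>

lemma q_eval_nonzero_cosparse:
  assumes radius: "1 \<le> fps_conv_radius F" and "F \<noteq> 0"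
  shows "\<forall>\<^sub>\<approx>z\<in>upper_half_plane. q_eval F z \<noteq> 0"
proof (rule ccontr)
  let ?H = upper_half_plane
  assume neg: "\<not> (\<forall>\<^sub>\<approx>z\<in>?H. q_eval F z \<noteq> 0)"
  have H: "open ?H" "connected ?H"
    by (simp_all add: open_halfspace_Im_gt convex_connected convex_halfspace_Im_gt)
  have holo: "q_eval F holomorphic_on ?H"
    by (rule holomorphic_q_eval[OF radius])
  have "q_eval F meromorphic_on ?H"
    using holo H(1) by (simp add: analytic_on_imp_meromorphic_on analytic_on_open)
  \<comment> \<open>A meromorphic function on a connected open set either equals 0 off a sparse set
    or avoids 0 off a sparse set. Continuity then strengthens the first case to vanishing
    everywhere.\<close>
  from meromorphic_imp_constant_or_avoid[OF this H, of 0] neg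
  have zero: "\<forall>\<^sub>\<approx>z\<in>?H. q_eval F z = 0"
    by blast
  have q_eval_0: "q_eval F z = 0" if z: "z \<in> ?H" for z
  proof (rule ccontr)
    assume nz: "q_eval F z \<noteq> 0"
    have "isCont (q_eval F) z"
      using holo z H(1) by (metis holomorphic_on_imp_continuous_on continuous_on_eq_continuous_at)
    then have "\<forall>\<^sub>F w in at z. q_eval F w \<noteq> 0"
      using nz by (metis isCont_def tendsto_imp_eventually_ne)
    moreover have "\<forall>\<^sub>F w in at z. q_eval F w = 0"
      using zero z by (rule eventually_cosparse_imp_eventually_at)
    ultimately have "\<forall>\<^sub>F w in at z. False"
      by eventually_elim simp
    then show False
      by simp
  qed
  have eval_0: "eval_fps (fps_X * F) w = 0" if w: "norm w < 1" for w
  proof (cases "w = 0")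
    case False
    define z where "z = Ln w / (2 * of_real pi * \<i>)"
    have exp_z: "exp (2 * of_real pi * \<i> * z) = w"
      using False by (simp add: z_def)
    have "Im z = - ln (norm w) / (2 * pi)"
      using False by (simp add: z_def Im_divide Re_Ln power2_eq_square field_simps)
    also have "\<dots> > 0"
      using False w by (simp add: divide_neg_pos)
    finally have "q_eval F z = 0"
      using q_eval_0 by simp
    then have "eval_fps F w = 0"
      by (simp add: q_eval_def exp_z)
    then show ?thesis
      using in_conv_radius[OF radius w] by (simp add: eval_fps_mult)
  qed (simp add: eval_fps_at_0)
  have "fps_X * F = 0"
  proof (rule eval_fps_eqD)
    show "fps_conv_radius (fps_X * F) > 0"
      by (rule less_le_trans[OF _ conv_radius_ge_1_arith(3)]) (simp_all add: radius)
    have "\<forall>\<^sub>F w in nhds 0. w \<in> ball (0 :: complex) 1"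
      by (rule eventually_nhds_in_open) auto
    then show "\<forall>\<^sub>F w in nhds 0. eval_fps (fps_X * F) w = eval_fps 0 w"
      by eventually_elim (simp add: eval_0)
  qed simp
  with \<open>F \<noteq> 0\<close> show False
    by simp
qed

section \<open>The Schwarz equation as an identity of meromorphic functions\<close>

theorem theorem5p2:
  fixes f :: "complex \<Rightarrow> complex"
  assumes f_def: "\<And>z. z \<in> upper_half_plane \<Longrightarrow> f z = z + 4 * (E4 z / deriv E4 z)"
  shows "f meromorphic_on upper_half_plane \<and>
         mero_eq_on upper_half_plane (schwarz_deriv f) (\<lambda>z. 4 * of_real pi ^ 2 * E4 z)"
proof -
  let ?H = upper_half_plane
  define c :: complex where "c = 2 * of_real pi * \<i>"
  have H: "open ?H"
    by (simp add: open_halfspace_Im_gt)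
  note radius = conv_radius_eisenstein
  note hom = q_eval_arith q_eval_power radius conv_radius_ge_1_power conv_radius_ge_1_arith(3)
    E4_conv_q_eval
  have deriv_q_eval: "(q_eval F has_field_derivative c * (q_eval G z / numeral m)) (at z)"
    if "numeral m * fps_theta F = G" "1 \<le> fps_conv_radius F" "z \<in> ?H" for F G m z
  proof -
    have "1 \<le> fps_conv_radius (fps_theta F)"
      unfolding fps_theta_def using that(2) order_trans[OF _ fps_conv_radius_deriv]
      by (intro conv_radius_ge_1_arith(3)) auto
    then have "q_eval G z = numeral m * q_eval (fps_theta F) z"
      using that by (auto simp: q_eval_arith q_eval_numeral)
    then show ?thesis
      using has_field_derivative_q_eval[OF that(2), of z] that(3) by (simp add: c_def)
  qed
  have dP: "(q_eval E2_fps has_field_derivative c * ((q_eval E2_fps z ^ 2 - E4 z) / 12)) (at z)"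
    if "z \<in> ?H" for z
    using deriv_q_eval[OF ramanujan_fps(1) radius(1) that] that
    by (simp add: hom)
  have dQ': "(q_eval E4_fps has_field_derivative c * ((q_eval E2_fps z * E4 z - q_eval E6_fps z) / 3)) (at z)"
    if "z \<in> ?H" for z
    using deriv_q_eval[OF ramanujan_fps(2) radius(2) that] that
    by (simp add: hom)
  have dQ: "(E4 has_field_derivative c * ((q_eval E2_fps z * E4 z - q_eval E6_fps z) / 3)) (at z)"
    if "z \<in> ?H" for z
    by (rule has_field_derivative_transform_within_open[OF dQ'[OF that] H that])
       (simp add: E4_conv_q_eval)
  have dR: "(q_eval E6_fps has_field_derivative c * ((q_eval E2_fps z * q_eval E6_fps z - E4 z ^ 2) / 2)) (at z)"
    if "z \<in> ?H" for z
    using deriv_q_eval[OF ramanujan_fps(3) radius(3) that] that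
    by (simp add: hom)

  define N_fps where "N_fps = E2_fps * E4_fps - E6_fps"
  define \<Delta>_fps where "\<Delta>_fps = E4_fps ^ 3 - E6_fps ^ 2"
  have N_radius: "1 \<le> fps_conv_radius N_fps" and \<Delta>_radius: "1 \<le> fps_conv_radius \<Delta>_fps"
    unfolding N_fps_def \<Delta>_fps_def by (intro conv_radius_ge_1_arith conv_radius_ge_1_power radius)+
  have sigma_1: "divisor_sigma k 1 = 1" for k
    by (simp add: divisor_sigma_def)
  \<comment> \<open>The series is \<open>3 * fps_theta E4_fps\<close>, whose coefficient at
    \<open>q\<close> is \<open>3 * 240\<close>.\<close>
  have "fps_nth N_fps 1 = 720"
    unfolding N_fps_def ramanujan_fps(2)[symmetric]
    using sigma_1 by (simp add: E4_fps_def sigma_fps_def)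
  then have "N_fps \<noteq> 0"
    by auto
  \<comment> \<open>The cube contributes \<open>3 * 240\<close> and the square
    \<open>2 * 504\<close>.\<close>
  have "fps_nth \<Delta>_fps 1 = 1728"
    using sigma_1 by (simp add: \<Delta>_fps_def E4_fps_def E6_fps_def sigma_fps_def eval_nat_numeral fps_mult_nth_1)
  then have "\<Delta>_fps \<noteq> 0"
    by auto

  define S where "S = ?H \<inter> (\<lambda>z. q_eval N_fps z * q_eval \<Delta>_fps z) -` (- {0})"
  have "open S"
    unfolding S_def
    by (intro continuous_open_preimage holomorphic_on_imp_continuous_on holomorphic_intros
        holomorphic_q_eval N_radius \<Delta>_radius H) auto
  have cosparse: "\<forall>\<^sub>\<approx>z\<in>?H. z \<in> S"
    using q_eval_nonzero_cosparse[OF N_radius \<open>N_fps \<noteq> 0\<close>]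
      q_eval_nonzero_cosparse[OF \<Delta>_radius \<open>\<Delta>_fps \<noteq> 0\<close>] eventually_in_cosparse[OF order.refl H]
    by eventually_elim (simp add: S_def)

  have nz: "q_eval E2_fps z * E4 z - q_eval E6_fps z \<noteq> 0" "E4 z ^ 3 - q_eval E6_fps z ^ 2 \<noteq> 0"
    if "z \<in> S" for z
    using that
    by (auto simp: S_def N_fps_def \<Delta>_fps_def hom)
  have S_H: "z \<in> ?H" if "z \<in> S" for z
    using that by (simp add: S_def)
  have "schwarz_deriv f z = - (c ^ 2) * E4 z" if "z \<in> S" for z
    by (rule schwarz_deriv_of_ramanujan[where S = S and P = "q_eval E2_fps" and R = "q_eval E6_fps"])
       (use \<open>open S\<close> dP dQ dR f_def nz S_H that in \<open>auto simp: c_def\<close>)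
  \<comment> \<open>The constant is right because \<open>c ^ 2 = - 4 * \<pi> ^ 2\<close>.\<close>
  then have schwarz: "\<forall>\<^sub>\<approx>z\<in>?H. schwarz_deriv f z = 4 * of_real pi ^ 2 * E4 z"
    using cosparse by (auto elim!: eventually_mono simp: c_def power_mult_distrib)

  have "E4 holomorphic_on ?H"
    using dQ H by (auto simp: holomorphic_on_open)
  then have E4_mero: "E4 meromorphic_on ?H"
    using H by (simp add: analytic_on_imp_meromorphic_on analytic_on_open)
  then have "(\<lambda>z. z + 4 * (E4 z / deriv E4 z)) meromorphic_on ?H"
    by (intro meromorphic_intros)
  moreover have f_ev: "\<forall>\<^sub>\<approx>z\<in>?H. f z = z + 4 * (E4 z / deriv E4 z)"
    using eventually_in_cosparse[OF order.refl H] by eventually_elim (rule f_def)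
  ultimately have "f meromorphic_on ?H"
    using meromorphic_on_cong'[OF f_ev refl] by simp
  moreover have rhs: "(\<lambda>z. 4 * of_real pi ^ 2 * E4 z) meromorphic_on ?H"
    using E4_mero by (intro meromorphic_intros)
  \<comment> \<open>Meromorphy is inherited from the right side, since the two functions agree off a
    sparse set.\<close>
  moreover have "schwarz_deriv f meromorphic_on ?H"
    using meromorphic_on_cong'[OF schwarz refl] rhs by blast
  ultimately show ?thesis
    using schwarz by (simp add: mero_eq_on_def)
qed

end
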